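(* Every brick-directed finite dimensional algebra over a field is weakly triangular.
   Context: For a finite dimensional algebra $A$ over a field, $\operatorname{mod} A$ is the category of finitely generated left $A$-modules. A brick is a module $X\in\operatorname{mod} A$ such that $\operatorname{End}_A(X)$ is a division algebra. A brick-cycle in $\operatorname{mod} A$ is a sequence $X_0\xrightarrow{f_1}X_1\xrightarrow{f_2}\cdots\xrightarrow{f_m}X_m$ with $m\ge 1$, all $X_i$ bricks, $X_0\simeq X_m$, and each $f_j$ non-zero and non-invertible. $A$ is brick-directed if $\operatorname{mod} A$ contains no brick-cycle. The Ext-quiver of $A$ has as vertices the isomorphism classes of simple modules, with a single arrow $S\to S'$ if and only if $\operatorname{Ext}^1_A(S,S')\neq 0$. $A$ is weakly triangular if the only oriented cycles in the Ext-quiver of $A$ are powers and compositions of loops (that is, no oriented cycle passes through two distinct vertices). *)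

theory Defs
  imports "Graph_Theory.Pair_Digraph" "HOL-Algebra.Module" "HOL-Algebra.AbelCoset"
begin

section \<open>Modules over a ring that need not be commutative\<close>

text \<open>
  The locale \<^locale>\<open>module\<close> of HOL-Algebra is restricted to commutative rings of scalars.
  Left modules reuse its record type; the multiplicative fields \<^const>\<open>mult\<close> and
  \<^const>\<open>one\<close> of that record play no role for a module.
\<close>

locale left_module = R?: ring R + M?: abelian_group M
  for R :: "('a, 'r) ring_scheme" (structure) and M :: "('a, 'm, 's) module_scheme" (structure) +
  assumes smult_closed [simp, intro]:
      "\<lbrakk>a \<in> carrier R; x \<in> carrier M\<rbrakk> \<Longrightarrow> a \<odot>\<^bsub>M\<^esub> x \<in> carrier M"
    and smult_l_distr:
      "\<lbrakk>a \<in> carrier R; b \<in> carrier R; x \<in> carrier M\<rbrakk> \<Longrightarrow>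
        (a \<oplus> b) \<odot>\<^bsub>M\<^esub> x = a \<odot>\<^bsub>M\<^esub> x \<oplus>\<^bsub>M\<^esub> b \<odot>\<^bsub>M\<^esub> x"
    and smult_r_distr:
      "\<lbrakk>a \<in> carrier R; x \<in> carrier M; y \<in> carrier M\<rbrakk> \<Longrightarrow>
        a \<odot>\<^bsub>M\<^esub> (x \<oplus>\<^bsub>M\<^esub> y) = a \<odot>\<^bsub>M\<^esub> x \<oplus>\<^bsub>M\<^esub> a \<odot>\<^bsub>M\<^esub> y"
    and smult_assoc:
      "\<lbrakk>a \<in> carrier R; b \<in> carrier R; x \<in> carrier M\<rbrakk> \<Longrightarrow>
        (a \<otimes> b) \<odot>\<^bsub>M\<^esub> x = a \<odot>\<^bsub>M\<^esub> (b \<odot>\<^bsub>M\<^esub> x)"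
    and smult_one [simp]:
      "x \<in> carrier M \<Longrightarrow> \<one> \<odot>\<^bsub>M\<^esub> x = x"

definition finitely_generated ::
    "('a, 'r) ring_scheme \<Rightarrow> ('a, 'm, 's) module_scheme \<Rightarrow> bool" where
  "finitely_generated R M \<longleftrightarrow>
    (\<exists>B. finite B \<and> B \<subseteq> carrier M \<and> (\<forall>N. submodule N R M \<and> B \<subseteq> N \<longrightarrow> N = carrier M))"

locale fg_left_module = left_module +
  assumes finitely_generated: "finitely_generated R M"

text \<open>Over the field \<open>K\<close>, finitely generated means finite dimensional.\<close>

locale fin_dim_algebra = K?: field K + A?: ring A + module K A
  for K :: "('k, 'x) ring_scheme" (structure) and A :: "('k, 'a, 'y) module_scheme" (structure) +
  assumes smult_mult_left:
      "\<lbrakk>c \<in> carrier K; x \<in> carrier A; y \<in> carrier A\<rbrakk> \<Longrightarrow>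
        (c \<odot>\<^bsub>A\<^esub> x) \<otimes>\<^bsub>A\<^esub> y = c \<odot>\<^bsub>A\<^esub> (x \<otimes>\<^bsub>A\<^esub> y)"
    and smult_mult_right:
      "\<lbrakk>c \<in> carrier K; x \<in> carrier A; y \<in> carrier A\<rbrakk> \<Longrightarrow>
        x \<otimes>\<^bsub>A\<^esub> (c \<odot>\<^bsub>A\<^esub> y) = c \<odot>\<^bsub>A\<^esub> (x \<otimes>\<^bsub>A\<^esub> y)"
    and finite_dimensional: "finitely_generated K A"

text \<open>
  Homomorphisms are taken extensional, so that equal maps on the carrier are equal as
  functions; this makes \<open>End\<close> below satisfy the ring axioms.
\<close>

definition module_hom ::
    "('a, 'r) ring_scheme \<Rightarrow> ('a, 'm, 's) module_scheme \<Rightarrow> ('a, 'n, 't) module_scheme \<Rightarrow>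
      ('m \<Rightarrow> 'n) set" where
  "module_hom R M N =
    {h \<in> carrier M \<rightarrow>\<^sub>E carrier N.
      (\<forall>x\<in>carrier M. \<forall>y\<in>carrier M. h (x \<oplus>\<^bsub>M\<^esub> y) = h x \<oplus>\<^bsub>N\<^esub> h y) \<and>
      (\<forall>a\<in>carrier R. \<forall>x\<in>carrier M. h (a \<odot>\<^bsub>M\<^esub> x) = a \<odot>\<^bsub>N\<^esub> h x)}"

definition module_iso ::
    "('a, 'r) ring_scheme \<Rightarrow> ('a, 'm, 's) module_scheme \<Rightarrow> ('a, 'n, 't) module_scheme \<Rightarrow>
      ('m \<Rightarrow> 'n) set" where
  "module_iso R M N = {h \<in> module_hom R M N. bij_betw h (carrier M) (carrier N)}"

definition isomorphic ::
    "('a, 'r) ring_scheme \<Rightarrow> ('a, 'm, 's) module_scheme \<Rightarrow> ('a, 'n, 't) module_scheme \<Rightarrow> bool" where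
  "isomorphic R M N \<longleftrightarrow> module_iso R M N \<noteq> {}"

definition zero_hom ::
    "('a, 'm, 's) module_scheme \<Rightarrow> ('a, 'n, 't) module_scheme \<Rightarrow> 'm \<Rightarrow> 'n" where
  "zero_hom M N = (\<lambda>x\<in>carrier M. \<zero>\<^bsub>N\<^esub>)"

definition End :: "('a, 'r) ring_scheme \<Rightarrow> ('a, 'm, 's) module_scheme \<Rightarrow> ('m \<Rightarrow> 'm) ring" where
  "End R M =
    \<lparr>carrier = module_hom R M M,
     mult = compose (carrier M),
     one = (\<lambda>x\<in>carrier M. x),
     zero = zero_hom M M,
     add = (\<lambda>f g. \<lambda>x\<in>carrier M. f x \<oplus>\<^bsub>M\<^esub> g x)\<rparr>"

locale division_ring = ring +
  assumes one_not_zero: "\<one> \<noteq> \<zero>"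
    and Units_eq: "Units R = carrier R - {\<zero>}"

text \<open>
  When \<open>A\<close> is a \<open>K\<close>-algebra, \<open>End A X\<close> is a \<open>K\<close>-algebra; being a division algebra is a
  condition on the underlying ring only.
\<close>

definition brick :: "('a, 'r) ring_scheme \<Rightarrow> ('a, 'm, 's) module_scheme \<Rightarrow> bool" where
  "brick A X \<longleftrightarrow> fg_left_module A X \<and> division_ring (End A X)"

definition simple_module :: "('a, 'r) ring_scheme \<Rightarrow> ('a, 'm, 's) module_scheme \<Rightarrow> bool" where
  "simple_module A S \<longleftrightarrow> left_module A S \<and> carrier S \<noteq> {\<zero>\<^bsub>S\<^esub>} \<and>
    (\<forall>N. submodule N A S \<longrightarrow> N = {\<zero>\<^bsub>S\<^esub>} \<or> N = carrier S)"


section \<open>The category of finitely generated modules\<close>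

text \<open>
  HOL cannot quantify over the types carrying the modules, so \<open>mod A\<close> consists of the
  finitely generated modules whose carrier is a set of lists over the type of \<open>A\<close>. This
  loses nothing: by the lemma \<open>fg_left_module_isomorphic_fg_modules\<close>, every finitely generated
  \<open>A\<close>-module, on whatever type, is isomorphic to one of these.
\<close>

type_synonym 'a list_module = "('a, 'a list) module"

definition fg_modules :: "('a, 'r) ring_scheme \<Rightarrow> 'a list_module set" where
  "fg_modules A = {M. fg_left_module A M}"

context left_module
begin

lemma smult_zero_left: "x \<in> carrier M \<Longrightarrow> \<zero> \<odot>\<^bsub>M\<^esub> x = \<zero>\<^bsub>M\<^esub>"
  by (metis M.add.r_cancel_one' R.r_zero R.zero_closed smult_closed smult_l_distr)

lemma smult_zero_right: "a \<in> carrier R \<Longrightarrow> a \<odot>\<^bsub>M\<^esub> \<zero>\<^bsub>M\<^esub> = \<zero>\<^bsub>M\<^esub>"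
  by (metis M.add.r_cancel_one' M.r_zero M.zero_closed smult_closed smult_r_distr)

lemma smult_uminus_one: "x \<in> carrier M \<Longrightarrow> (\<ominus> \<one>) \<odot>\<^bsub>M\<^esub> x = \<ominus>\<^bsub>M\<^esub> x"
  by (metis M.minus_equality R.a_inv_closed R.l_neg R.one_closed smult_closed smult_l_distr
      smult_one smult_zero_left)

lemma submoduleI:
  assumes "H \<subseteq> carrier M" "\<zero>\<^bsub>M\<^esub> \<in> H"
    and "\<And>x y. \<lbrakk>x \<in> H; y \<in> H\<rbrakk> \<Longrightarrow> x \<oplus>\<^bsub>M\<^esub> y \<in> H"
    and "\<And>a x. \<lbrakk>a \<in> carrier R; x \<in> H\<rbrakk> \<Longrightarrow> a \<odot>\<^bsub>M\<^esub> x \<in> H"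
  shows "submodule H R M"
proof (intro submodule.intro subgroup.intro)
  fix x assume x: "x \<in> H"
  then have "(\<ominus> \<one>) \<odot>\<^bsub>M\<^esub> x \<in> H" using assms(4) by blast
  then show "inv\<^bsub>add_monoid M\<^esub> x \<in> H"
    using x assms(1) smult_uminus_one[of x] by (auto simp: a_inv_def)
qed (use assms in \<open>auto simp: submodule_axioms_def\<close>)

fun lincomb where
  "lincomb (a # as) (b # bs) = a \<odot>\<^bsub>M\<^esub> b \<oplus>\<^bsub>M\<^esub> lincomb as bs"
| "lincomb _ _ = \<zero>\<^bsub>M\<^esub>"

lemma lincomb_closed:
  "\<lbrakk>set as \<subseteq> carrier R; set bs \<subseteq> carrier M\<rbrakk> \<Longrightarrow> lincomb as bs \<in> carrier M"
  by (induction as bs rule: lincomb.induct) auto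

lemma lincomb_add:
  assumes "length as = length bs" "length as' = length bs"
    and "set as \<subseteq> carrier R" "set as' \<subseteq> carrier R" "set bs \<subseteq> carrier M"
  shows "lincomb as bs \<oplus>\<^bsub>M\<^esub> lincomb as' bs = lincomb (map2 (\<oplus>) as as') bs"
  using assms
proof (induction bs arbitrary: as as')
  case (Cons b bs)
  then obtain a as1 a' as1' where *: "as = a # as1" "as' = a' # as1'"
    by (metis length_Suc_conv)
  then have "lincomb as1 bs \<in> carrier M" "lincomb as1' bs \<in> carrier M"
    using Cons.prems by (auto intro: lincomb_closed)
  moreover have "lincomb as1 bs \<oplus>\<^bsub>M\<^esub> lincomb as1' bs = lincomb (map2 (\<oplus>) as1 as1') bs"
    using * Cons by auto
  then have "lincomb (map2 (\<oplus>) as as') (b # bs) =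
      (a \<oplus> a') \<odot>\<^bsub>M\<^esub> b \<oplus>\<^bsub>M\<^esub> (lincomb as1 bs \<oplus>\<^bsub>M\<^esub> lincomb as1' bs)"
    using * by simp
  ultimately show ?case
    using * Cons.prems by (auto simp: smult_l_distr M.a_ac)
qed auto

lemma lincomb_smult:
  assumes "a \<in> carrier R" "set as \<subseteq> carrier R" "set bs \<subseteq> carrier M"
  shows "a \<odot>\<^bsub>M\<^esub> lincomb as bs = lincomb (map ((\<otimes>) a) as) bs"
  using assms
  by (induction as bs rule: lincomb.induct)
     (auto simp: smult_zero_right smult_r_distr smult_assoc lincomb_closed)

lemma lincomb_zero:
  "set bs \<subseteq> carrier M \<Longrightarrow> lincomb (map (\<lambda>_. \<zero>) bs) bs = \<zero>\<^bsub>M\<^esub>"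
  by (induction bs) (auto simp: smult_zero_left)

lemma lincomb_single:
  "\<lbrakk>set bs \<subseteq> carrier M; b \<in> set bs\<rbrakk> \<Longrightarrow>
    \<exists>as. length as = length bs \<and> set as \<subseteq> carrier R \<and> lincomb as bs = b"
proof (induction bs)
  case (Cons c bs)
  show ?case
  proof (cases "b = c")
    case True
    then show ?thesis
      using Cons.prems lincomb_zero[of bs]
      by (intro exI[of _ "\<one> # map (\<lambda>_. \<zero>) bs"]) auto
  next
    case False
    then obtain as where "length as = length bs" "set as \<subseteq> carrier R" "lincomb as bs = b"
      using Cons by auto
    then show ?thesis
      using Cons.prems by (intro exI[of _ "\<zero> # as"]) (auto simp: smult_zero_left)
  qed
qed simp

end

lemma (in fg_left_module) inj_into_lists:
  "\<exists>g. inj_on g (carrier M) \<and> g ` carrier M \<subseteq> lists (carrier R)"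
proof -
  obtain B where B: "finite B" "B \<subseteq> carrier M"
    and gen: "\<And>N. \<lbrakk>submodule N R M; B \<subseteq> N\<rbrakk> \<Longrightarrow> N = carrier M"
    using finitely_generated unfolding finitely_generated_def by blast
  obtain bs where bs: "set bs = B" using B finite_list by blast
  let ?P = "\<lambda>as. length as = length bs \<and> set as \<subseteq> carrier R"
  define N where "N = {lincomb as bs | as. ?P as}"
  have "submodule N R M"
  proof (rule submoduleI)
    show "N \<subseteq> carrier M" unfolding N_def using B bs by (auto intro: lincomb_closed)
    show "\<zero>\<^bsub>M\<^esub> \<in> N"
      unfolding N_def using lincomb_zero[of bs] B bs
      by (auto intro!: exI[of _ "map (\<lambda>_. \<zero>) bs"])
    fix x assume "x \<in> N"
    then obtain as where as: "?P as" "x = lincomb as bs" unfolding N_def by blast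
    show "x \<oplus>\<^bsub>M\<^esub> y \<in> N" if "y \<in> N" for y
    proof -
      from that obtain as' where as': "?P as'" "y = lincomb as' bs" unfolding N_def by blast
      have "set (map2 (\<oplus>) as as') \<subseteq> carrier R"
        using as as' by (auto dest: set_zip_leftD set_zip_rightD intro!: R.a_closed)
      then show ?thesis
        unfolding N_def using as as' lincomb_add[of as bs as'] B bs
        by (auto intro!: exI[of _ "map2 (\<oplus>) as as'"])
    qed
    show "a \<odot>\<^bsub>M\<^esub> x \<in> N" if "a \<in> carrier R" for a
      unfolding N_def using as that lincomb_smult[of a as bs] B bs
      by (auto intro!: exI[of _ "map ((\<otimes>) a) as"] R.m_closed)
  qed
  moreover have "B \<subseteq> N" unfolding N_def using lincomb_single[of bs] B bs by blast
  ultimately have N: "N = carrier M" by (rule gen)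
  define g where "g x = (SOME as. ?P as \<and> lincomb as bs = x)" for x
  have g: "?P (g x) \<and> lincomb (g x) bs = x" if "x \<in> carrier M" for x
  proof -
    have "x \<in> N" using that N by simp
    then have "\<exists>as. ?P as \<and> lincomb as bs = x" unfolding N_def by blast
    then show ?thesis unfolding g_def by (rule someI_ex)
  qed
  then have "inj_on g (carrier M)" by (metis inj_onI)
  moreover have "g ` carrier M \<subseteq> lists (carrier R)" using g by auto
  ultimately show ?thesis by blast
qed

theorem fg_left_module_isomorphic_fg_modules:
  fixes A :: "('a, 'r) ring_scheme" and M :: "('a, 'm, 's) module_scheme"
  assumes "fg_left_module A M"
  shows "\<exists>N \<in> fg_modules A. isomorphic A M N"
proof -
  interpret fg_left_module A M by fact
  obtain g :: "'m \<Rightarrow> 'a list" where g: "inj_on g (carrier M)"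
    using inj_into_lists by blast
  define h where "h = inv_into (carrier M) g"
  have hg [simp]: "h (g x) = x" if "x \<in> carrier M" for x
    using g that unfolding h_def by simp
  define N :: "'a list_module" where
    "N = \<lparr>carrier = g ` carrier M, mult = (\<lambda>_ _. []), one = [], zero = g \<zero>\<^bsub>M\<^esub>,
          add = (\<lambda>x y. g (h x \<oplus>\<^bsub>M\<^esub> h y)), smult = (\<lambda>a x. g (a \<odot>\<^bsub>M\<^esub> h x))\<rparr>"
  have [simp]: "carrier N = g ` carrier M" "\<zero>\<^bsub>N\<^esub> = g \<zero>\<^bsub>M\<^esub>"
    "x \<oplus>\<^bsub>N\<^esub> y = g (h x \<oplus>\<^bsub>M\<^esub> h y)" "a \<odot>\<^bsub>N\<^esub> x = g (a \<odot>\<^bsub>M\<^esub> h x)" for x y a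
    by (auto simp: N_def)
  have "abelian_group N"
  proof (rule abelian_groupI)
    fix x assume "x \<in> carrier N"
    then obtain m where m: "m \<in> carrier M" "x = g m" by auto
    then have "g (\<ominus>\<^bsub>M\<^esub> m) \<in> carrier N" "g (\<ominus>\<^bsub>M\<^esub> m) \<oplus>\<^bsub>N\<^esub> x = \<zero>\<^bsub>N\<^esub>"
      using M.l_neg by simp_all
    then show "\<exists>y\<in>carrier N. y \<oplus>\<^bsub>N\<^esub> x = \<zero>\<^bsub>N\<^esub>" by blast
  qed (auto simp: M.a_ac)
  then interpret N: abelian_group N .
  interpret N: left_module A N
    by unfold_locales (auto simp: smult_l_distr smult_r_distr smult_assoc)
  have "finitely_generated A N"
  proof -
    obtain B where B: "finite B" "B \<subseteq> carrier M"
      and gen: "\<And>N. \<lbrakk>submodule N A M; B \<subseteq> N\<rbrakk> \<Longrightarrow> N = carrier M"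
      using finitely_generated unfolding finitely_generated_def by blast
    have "U = carrier N" if U: "submodule U A N" "g ` B \<subseteq> U" for U
    proof -
      interpret U: submodule U A N by fact
      have sub: "U \<subseteq> g ` carrier M" using U.subset by simp
      have "submodule {x \<in> carrier M. g x \<in> U} A M"
      proof (rule submoduleI, goal_cases)
        case 2 then show ?case using U.one_closed by simp
      next
        case (3 x y) then show ?case using U.m_closed[of "g x" "g y"] by simp
      next
        case (4 a x) then show ?case using U.smult_closed[of a "g x"] by simp
      qed auto
      then have "{x \<in> carrier M. g x \<in> U} = carrier M"
        by (rule gen) (use B U in auto)
      then show ?thesis using sub by auto
    qed
    then show ?thesis
      unfolding finitely_generated_def using B by (intro exI[of _ "g ` B"]) auto
  qed
  then have "fg_left_module A N" by unfold_locales
  moreover have "restrict g (carrier M) \<in> module_iso A M N"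
    using g by (auto simp: module_iso_def module_hom_def bij_betw_def)
  ultimately show ?thesis unfolding fg_modules_def isomorphic_def by blast
qed

text \<open>The morphism \<open>f i\<close> below is the arrow from \<open>X i\<close> to \<open>X (Suc i)\<close>.\<close>

definition brick_cycle ::
    "('a, 'r) ring_scheme \<Rightarrow> nat \<Rightarrow> (nat \<Rightarrow> 'a list_module) \<Rightarrow> (nat \<Rightarrow> 'a list \<Rightarrow> 'a list) \<Rightarrow> bool" where
  "brick_cycle A m X f \<longleftrightarrow>
    m \<ge> 1 \<and> (\<forall>i\<le>m. brick A (X i)) \<and> isomorphic A (X 0) (X m) \<and>
    (\<forall>i<m. f i \<in> module_hom A (X i) (X (Suc i)) \<and>
      f i \<noteq> zero_hom (X i) (X (Suc i)) \<and> f i \<notin> module_iso A (X i) (X (Suc i)))"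

definition brick_directed :: "('a, 'r) ring_scheme \<Rightarrow> bool" where
  "brick_directed A \<longleftrightarrow> (\<nexists>m X f. brick_cycle A m X f)"


section \<open>The first extension group\<close>

text \<open>
  \<open>Ext1 A X Y\<close> is the set of Yoneda equivalence classes of short exact sequences
  \<open>0 \<rightarrow> Y \<rightarrow> E \<rightarrow> X \<rightarrow> 0\<close> in \<open>mod A\<close>, such a sequence being given as the triple \<open>(E, i, p)\<close>.
  Under the Baer sum the zero element is the class of the split extensions.
\<close>

type_synonym ('a, 'm, 'n) extension =
  "'a list_module \<times> ('n \<Rightarrow> 'a list) \<times> ('a list \<Rightarrow> 'm)"

definition extensions ::
    "('a, 'r) ring_scheme \<Rightarrow> ('a, 'm, 's) module_scheme \<Rightarrow> ('a, 'n, 't) module_scheme \<Rightarrow>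
      ('a, 'm, 'n) extension set" where
  "extensions A X Y =
    {(E, i, p). E \<in> fg_modules A \<and> i \<in> module_hom A Y E \<and> p \<in> module_hom A E X \<and>
      inj_on i (carrier Y) \<and> i ` carrier Y = a_kernel E X p \<and> p ` carrier E = carrier X}"

definition extension_equiv ::
    "('a, 'r) ring_scheme \<Rightarrow> ('a, 'm, 's) module_scheme \<Rightarrow> ('a, 'n, 't) module_scheme \<Rightarrow>
      ('a, 'm, 'n) extension rel" where
  "extension_equiv A X Y =
    {((E, i, p), (E', i', p')).
      (E, i, p) \<in> extensions A X Y \<and> (E', i', p') \<in> extensions A X Y \<and>
      (\<exists>h \<in> module_iso A E E'.
        (\<forall>y\<in>carrier Y. h (i y) = i' y) \<and> (\<forall>e\<in>carrier E. p' (h e) = p e))}"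

definition Ext1 ::
    "('a, 'r) ring_scheme \<Rightarrow> ('a, 'm, 's) module_scheme \<Rightarrow> ('a, 'n, 't) module_scheme \<Rightarrow>
      ('a, 'm, 'n) extension set set" where
  "Ext1 A X Y = extensions A X Y // extension_equiv A X Y"

definition Ext1_zero ::
    "('a, 'r) ring_scheme \<Rightarrow> ('a, 'm, 's) module_scheme \<Rightarrow> ('a, 'n, 't) module_scheme \<Rightarrow>
      ('a, 'm, 'n) extension set" where
  "Ext1_zero A X Y =
    {(E, i, p) \<in> extensions A X Y. \<exists>s \<in> module_hom A X E. \<forall>x\<in>carrier X. p (s x) = x}"


section \<open>The Ext-quiver\<close>

definition simple_modules :: "('a, 'r) ring_scheme \<Rightarrow> 'a list_module set" where
  "simple_modules A = {S \<in> fg_modules A. simple_module A S}"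

definition iso_rel :: "('a, 'r) ring_scheme \<Rightarrow> 'a list_module rel" where
  "iso_rel A = {(M, N). M \<in> fg_modules A \<and> N \<in> fg_modules A \<and> isomorphic A M N}"

definition iso_class :: "('a, 'r) ring_scheme \<Rightarrow> 'a list_module \<Rightarrow> 'a list_module set" where
  "iso_class A M = iso_rel A `` {M}"

definition Ext_quiver :: "('a, 'r) ring_scheme \<Rightarrow> 'a list_module set pair_pre_digraph" where
  "Ext_quiver A =
    \<lparr>pverts = iso_class A ` simple_modules A,
     parcs = {(iso_class A S, iso_class A T) | S T.
       S \<in> simple_modules A \<and> T \<in> simple_modules A \<and> \<not> Ext1 A S T \<subseteq> {Ext1_zero A S T}}\<rparr>"

definition weakly_triangular :: "('a, 'r) ring_scheme \<Rightarrow> bool" where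
  "weakly_triangular A \<longleftrightarrow>
    (\<forall>u c. c \<noteq> [] \<and> pre_digraph.awalk (with_proj (Ext_quiver A)) u c u \<longrightarrow>
      (\<forall>v \<in> set (pre_digraph.awalk_verts (with_proj (Ext_quiver A)) u c). v = u))"

end

theory Submission
  imports Defs
begin

text \<open>
  If \<open>S \<rightarrow> T\<close> is an arrow of the Ext-quiver with \<open>S\<close> and \<open>T\<close> not isomorphic, a non-split extension
  \<open>0 \<rightarrow> T \<rightarrow> E \<rightarrow> S \<rightarrow> 0\<close> has a uniserial middle term with distinct composition factors, which is
  therefore a brick. So \<open>T \<rightarrow> E \<rightarrow> S\<close> is a path of bricks with non-zero, non-invertible maps, and an
  oriented cycle through two distinct vertices, read backwards, becomes a brick-cycle.
\<close>

section \<open>Homomorphisms of left modules\<close>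

text \<open>The submodules of \<open>E\<close> form a chain of three, so a non-zero endomorphism has
  two possible kernels and two possible images. Bijectivity is read off this chain by moving the
  copy of \<open>T\<close> forward and back along the map, without counting lengths. For a
  self-extension of \<open>S\<close> the composite \<open>E\<close> \<rightarrow> \<open>S\<close>
  \<rightarrow> \<open>E\<close> is non-zero and non-invertible; hence loops give no brick and are
  skipped when a walk is translated.

  The other difficulty is that vertices are isomorphism classes and an arc only supplies some
  representatives. Brick paths are therefore stated for arbitrary simple representatives at their
  ends, the connecting isomorphisms being absorbed into the maps to and from \<open>E\<close>, so
  that successive paths meet in one and the same module.\<close>

lemma (in left_module) submoduleD:
  assumes "submodule U R M"
  shows "U \<subseteq> carrier M" "\<zero>\<^bsub>M\<^esub> \<in> U"
    and "\<lbrakk>x \<in> U; y \<in> U\<rbrakk> \<Longrightarrow> x \<oplus>\<^bsub>M\<^esub> y \<in> U"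
    and "x \<in> U \<Longrightarrow> \<ominus>\<^bsub>M\<^esub> x \<in> U"
    and "\<lbrakk>a \<in> carrier R; x \<in> U\<rbrakk> \<Longrightarrow> a \<odot>\<^bsub>M\<^esub> x \<in> U"
proof -
  interpret U: submodule U R M by fact
  show "U \<subseteq> carrier M" "\<zero>\<^bsub>M\<^esub> \<in> U"
    using U.subset U.one_closed by simp_all
  show "\<lbrakk>x \<in> U; y \<in> U\<rbrakk> \<Longrightarrow> x \<oplus>\<^bsub>M\<^esub> y \<in> U" using U.m_closed by simp
  show "x \<in> U \<Longrightarrow> \<ominus>\<^bsub>M\<^esub> x \<in> U" using U.m_inv_closed by (simp add: a_inv_def)
  show "\<lbrakk>a \<in> carrier R; x \<in> U\<rbrakk> \<Longrightarrow> a \<odot>\<^bsub>M\<^esub> x \<in> U" by (rule U.smult_closed)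
qed

lemma (in left_module) eq_if_add_uminus_eq_zero:
  assumes "x \<in> carrier M" "y \<in> carrier M" "x \<oplus>\<^bsub>M\<^esub> \<ominus>\<^bsub>M\<^esub> y = \<zero>\<^bsub>M\<^esub>"
  shows "x = y"
  using M.minus_equality[OF assms(3)] assms by simp

lemma (in left_module) smult_uminus:
  assumes "a \<in> carrier R" "x \<in> carrier M"
  shows "a \<odot>\<^bsub>M\<^esub> (\<ominus>\<^bsub>M\<^esub> x) = \<ominus>\<^bsub>M\<^esub> (a \<odot>\<^bsub>M\<^esub> x)"
proof -
  have "a \<odot>\<^bsub>M\<^esub> (\<ominus>\<^bsub>M\<^esub> x) \<oplus>\<^bsub>M\<^esub> a \<odot>\<^bsub>M\<^esub> x = \<zero>\<^bsub>M\<^esub>"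
    using assms by (simp add: smult_r_distr[symmetric] M.l_neg smult_zero_right)
  then show ?thesis using M.minus_equality[of _ "a \<odot>\<^bsub>M\<^esub> x"] assms by simp
qed

lemma (in left_module) submodule_carrier: "submodule (carrier M) R M"
  by (rule submoduleI) auto

lemma (in left_module) id_in_module_hom: "(\<lambda>x\<in>carrier M. x) \<in> module_hom R M M"
  by (auto simp: module_hom_def)

lemma module_hom_compose:
  assumes "left_module R L" "f \<in> module_hom R L M" "g \<in> module_hom R M N"
  shows "compose (carrier L) g f \<in> module_hom R L N"
proof -
  interpret left_module R L by fact
  show ?thesis using assms(2,3)
    by (auto simp: module_hom_def compose_def PiE_iff)
qed

locale left_module_hom = M: left_module R M + N: left_module R N
  for R :: "('a, 'r) ring_scheme" and M :: "('a, 'm, 's) module_scheme"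
    and N :: "('a, 'n, 't) module_scheme" +
  fixes h
  assumes hom: "h \<in> module_hom R M N"
begin

lemma hom_closed [simp, intro]: "x \<in> carrier M \<Longrightarrow> h x \<in> carrier N"
  using hom by (auto simp: module_hom_def)

lemma hom_add [simp]:
  "\<lbrakk>x \<in> carrier M; y \<in> carrier M\<rbrakk> \<Longrightarrow> h (x \<oplus>\<^bsub>M\<^esub> y) = h x \<oplus>\<^bsub>N\<^esub> h y"
  using hom by (auto simp: module_hom_def)

lemma hom_smult [simp]:
  "\<lbrakk>a \<in> carrier R; x \<in> carrier M\<rbrakk> \<Longrightarrow> h (a \<odot>\<^bsub>M\<^esub> x) = a \<odot>\<^bsub>N\<^esub> h x"
  using hom by (auto simp: module_hom_def)

lemma hom_extensional: "h \<in> extensional (carrier M)"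
  using hom by (auto simp: module_hom_def PiE_def)

lemma hom_zero [simp]: "h \<zero>\<^bsub>M\<^esub> = \<zero>\<^bsub>N\<^esub>"
  by (metis M.zero_closed M.R.zero_closed M.smult_zero_left N.smult_zero_left hom_closed hom_smult)

lemma hom_uminus [simp]: "x \<in> carrier M \<Longrightarrow> h (\<ominus>\<^bsub>M\<^esub> x) = \<ominus>\<^bsub>N\<^esub> h x"
  by (metis M.R.a_inv_closed M.R.one_closed M.smult_uminus_one N.smult_uminus_one hom_closed
      hom_smult)

lemma kernel_iff: "x \<in> a_kernel M N h \<longleftrightarrow> x \<in> carrier M \<and> h x = \<zero>\<^bsub>N\<^esub>"
  by (simp add: a_kernel_def')

lemma submodule_vimage:
  assumes "submodule V R N"
  shows "submodule {x \<in> carrier M. h x \<in> V} R M"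
  by (rule M.submoduleI) (use N.submoduleD[OF assms] in auto)

lemma submodule_image:
  assumes "submodule U R M"
  shows "submodule (h ` U) R N"
proof -
  note U = M.submoduleD[OF assms]
  show ?thesis
  proof (rule N.submoduleI)
    show "h ` U \<subseteq> carrier N" using U(1) by auto
    show "\<zero>\<^bsub>N\<^esub> \<in> h ` U" using U(2) hom_zero by (metis imageI)
    fix x assume "x \<in> h ` U"
    then obtain u where u: "u \<in> U" "x = h u" by blast
    show "x \<oplus>\<^bsub>N\<^esub> y \<in> h ` U" if "y \<in> h ` U" for y
    proof -
      from that obtain v where "v \<in> U" "y = h v" by blast
      moreover from this have "u \<in> carrier M" "v \<in> carrier M" using u U(1) by auto
      ultimately show ?thesis using u U(3) by (intro image_eqI[of _ _ "u \<oplus>\<^bsub>M\<^esub> v"]) simp_all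
    qed
    show "a \<odot>\<^bsub>N\<^esub> x \<in> h ` U" if "a \<in> carrier R" for a
      using that u U(1,5) by (intro image_eqI[of _ _ "a \<odot>\<^bsub>M\<^esub> u"]) auto
  qed
qed

lemma submodule_kernel: "submodule (a_kernel M N h) R M"
  by (rule M.submoduleI) (auto simp: kernel_iff M.smult_zero_right N.smult_zero_right)

lemma inj_iff_kernel: "inj_on h (carrier M) \<longleftrightarrow> a_kernel M N h = {\<zero>\<^bsub>M\<^esub>}"
proof
  assume "inj_on h (carrier M)"
  then show "a_kernel M N h = {\<zero>\<^bsub>M\<^esub>}"
    by (auto simp: kernel_iff dest: inj_onD[of h "carrier M" _ "\<zero>\<^bsub>M\<^esub>"])
next
  assume ker: "a_kernel M N h = {\<zero>\<^bsub>M\<^esub>}"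
  show "inj_on h (carrier M)"
  proof (rule inj_onI)
    fix x y assume xy: "x \<in> carrier M" "y \<in> carrier M" "h x = h y"
    then have "x \<oplus>\<^bsub>M\<^esub> \<ominus>\<^bsub>M\<^esub> y \<in> a_kernel M N h" by (simp add: kernel_iff N.r_neg)
    then show "x = y" using ker xy by (metis M.eq_if_add_uminus_eq_zero singletonD)
  qed
qed

lemma zero_homI: "(\<And>x. x \<in> carrier M \<Longrightarrow> h x = \<zero>\<^bsub>N\<^esub>) \<Longrightarrow> h = zero_hom M N"
  using hom_extensional by (intro extensionalityI[of _ "carrier M"]) (auto simp: zero_hom_def)

text \<open>Linearity comes from injectivity: by \<open>gI\<close>, a value of the inverse is
  identified by applying \<open>h\<close>. The restriction to \<open>carrier N\<close> is there
  because members of \<open>module_hom\<close> are extensional and \<open>inv_into\<close> is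
  not.\<close>

lemma inverse_in_module_iso:
  assumes "bij_betw h (carrier M) (carrier N)"
  shows "(\<lambda>y\<in>carrier N. inv_into (carrier M) h y) \<in> module_iso R N M"
proof -
  let ?g = "inv_into (carrier M) h"
  have g: "?g y \<in> carrier M" "h (?g y) = y" if "y \<in> carrier N" for y
    using assms that by (auto simp: bij_betw_def f_inv_into_f inv_into_into)
  have gI: "?g y = x" if "x \<in> carrier M" "h x = y" for x y
    using assms that by (auto simp: bij_betw_def)
  have "(\<lambda>y\<in>carrier N. ?g y) \<in> module_hom R N M"
    using g by (auto simp: module_hom_def intro!: gI)
  moreover have "bij_betw (\<lambda>y\<in>carrier N. ?g y) (carrier N) (carrier M)"
    using bij_betw_inv_into[OF assms] by simp
  ultimately show ?thesis by (simp add: module_iso_def)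
qed

end

lemma isomorphic_refl: "left_module R M \<Longrightarrow> isomorphic R M M"
  using left_module.id_in_module_hom[of R M]
  by (auto simp: isomorphic_def module_iso_def bij_betw_def
      intro!: exI[of _ "\<lambda>x\<in>carrier M. x"] inj_onI)

lemma isomorphic_sym:
  assumes "left_module R M" "left_module R N" "isomorphic R M N"
  shows "isomorphic R N M"
proof -
  obtain h where "h \<in> module_iso R M N" using assms by (auto simp: isomorphic_def)
  then interpret left_module_hom R M N h
    using assms by (simp add: left_module_hom_def left_module_hom_axioms_def module_iso_def)
  show ?thesis
    using inverse_in_module_iso \<open>h \<in> module_iso R M N\<close>
    by (auto simp: isomorphic_def module_iso_def)
qed

lemma isomorphic_trans:
  assumes "left_module R L" "isomorphic R L M" "isomorphic R M N"
  shows "isomorphic R L N"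
proof -
  obtain f g where fg: "f \<in> module_iso R L M" "g \<in> module_iso R M N"
    using assms by (auto simp: isomorphic_def)
  then have "compose (carrier L) g f \<in> module_hom R L N"
    using module_hom_compose[OF assms(1)] by (auto simp: module_iso_def)
  moreover have "bij_betw (compose (carrier L) g f) (carrier L) (carrier N)"
    using fg by (auto simp: module_iso_def intro: bij_betw_compose)
  ultimately show ?thesis by (auto simp: isomorphic_def module_iso_def)
qed

section \<open>Endomorphism rings and bricks\<close>

text \<open>\<open>division_ring\<close> contains the ring axioms, so they have to be established
  before any module can be called a brick. Equality in \<open>End R M\<close> is equality of
  functions, which \<open>ext\<close> reduces to the carrier.\<close>

lemma (in left_module) ring_End: "ring (End R M)"
proof -
  have End_simps [simp]: "carrier (End R M) = module_hom R M M" "\<one>\<^bsub>End R M\<^esub> = (\<lambda>x\<in>carrier M. x)"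
    "\<zero>\<^bsub>End R M\<^esub> = zero_hom M M" "f \<otimes>\<^bsub>End R M\<^esub> g = compose (carrier M) f g"
    "f \<oplus>\<^bsub>End R M\<^esub> g = (\<lambda>x\<in>carrier M. f x \<oplus>\<^bsub>M\<^esub> g x)" for f g
    by (auto simp: End_def)
  have hom: "left_module_hom R M M f" if "f \<in> module_hom R M M" for f
    using that by unfold_locales
  have closed: "f x \<in> carrier M" if "f \<in> module_hom R M M" "x \<in> carrier M" for f x
    using that by (auto simp: module_hom_def)
  have ext: "f = g" if "f \<in> module_hom R M M" "g \<in> module_hom R M M"
      "\<And>x. x \<in> carrier M \<Longrightarrow> f x = g x" for f g
    using that by (intro extensionalityI[of f "carrier M" g]) (auto simp: module_hom_def PiE_def)
  have add: "(\<lambda>x\<in>carrier M. f x \<oplus>\<^bsub>M\<^esub> g x) \<in> module_hom R M M"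
    if "f \<in> module_hom R M M" "g \<in> module_hom R M M" for f g
  proof -
    interpret f: left_module_hom R M M f using that(1) by (rule hom)
    interpret g: left_module_hom R M M g using that(2) by (rule hom)
    show ?thesis by (auto simp: module_hom_def M.a_ac smult_r_distr)
  qed
  have zero: "zero_hom M M \<in> module_hom R M M"
    by (auto simp: zero_hom_def module_hom_def smult_zero_right)
  have comp: "compose (carrier M) f g \<in> module_hom R M M"
    if "f \<in> module_hom R M M" "g \<in> module_hom R M M" for f g
    using module_hom_compose[OF left_module_axioms that(2,1)] .
  have "abelian_group (End R M)"
  proof (rule abelian_groupI)
    fix f assume "f \<in> carrier (End R M)"
    then have f: "f \<in> module_hom R M M" by simp
    interpret f: left_module_hom R M M f using f by (rule hom)
    let ?g = "\<lambda>x\<in>carrier M. \<ominus>\<^bsub>M\<^esub> f x"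
    have "?g \<in> module_hom R M M"
      by (auto simp: module_hom_def M.minus_add smult_uminus)
    moreover have "?g \<oplus>\<^bsub>End R M\<^esub> f = \<zero>\<^bsub>End R M\<^esub>"
      by (auto simp: zero_hom_def M.l_neg)
    ultimately show "\<exists>g\<in>carrier (End R M). g \<oplus>\<^bsub>End R M\<^esub> f = \<zero>\<^bsub>End R M\<^esub>"
      unfolding End_simps(1) by blast
  next
    fix f assume "f \<in> carrier (End R M)"
    then have f: "f \<in> module_hom R M M" by simp
    show "\<zero>\<^bsub>End R M\<^esub> \<oplus>\<^bsub>End R M\<^esub> f = f"
      using ext[OF add[OF zero f] f] by (simp add: zero_hom_def closed[OF f])
  qed (auto simp: add zero closed M.a_ac intro!: restrict_ext)
  moreover have "monoid (End R M)"
  proof (rule monoidI)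
    show "\<one>\<^bsub>End R M\<^esub> \<in> carrier (End R M)" using id_in_module_hom by simp
    fix f g k
    assume "f \<in> carrier (End R M)" "g \<in> carrier (End R M)" "k \<in> carrier (End R M)"
    then show "f \<otimes>\<^bsub>End R M\<^esub> g \<otimes>\<^bsub>End R M\<^esub> k = f \<otimes>\<^bsub>End R M\<^esub> (g \<otimes>\<^bsub>End R M\<^esub> k)"
      by (auto simp: compose_def closed intro!: restrict_ext)
  next
    fix f assume "f \<in> carrier (End R M)"
    then have f: "f \<in> module_hom R M M" by simp
    show "\<one>\<^bsub>End R M\<^esub> \<otimes>\<^bsub>End R M\<^esub> f = f" "f \<otimes>\<^bsub>End R M\<^esub> \<one>\<^bsub>End R M\<^esub> = f"
      using ext[OF comp[OF id_in_module_hom f] f] ext[OF comp[OF f id_in_module_hom] f]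
      by (simp_all add: compose_eq closed[OF f])
  qed (simp add: comp)
  ultimately show ?thesis
  proof (rule ringI)
    fix f g k
    assume "f \<in> carrier (End R M)" "g \<in> carrier (End R M)" "k \<in> carrier (End R M)"
    then have fgk: "f \<in> module_hom R M M" "g \<in> module_hom R M M" "k \<in> module_hom R M M"
      by auto
    show "(f \<oplus>\<^bsub>End R M\<^esub> g) \<otimes>\<^bsub>End R M\<^esub> k = f \<otimes>\<^bsub>End R M\<^esub> k \<oplus>\<^bsub>End R M\<^esub> g \<otimes>\<^bsub>End R M\<^esub> k"
      using fgk by (auto simp: compose_def closed)
    interpret k: left_module_hom R M M k using fgk(3) by (rule hom)
    show "k \<otimes>\<^bsub>End R M\<^esub> (f \<oplus>\<^bsub>End R M\<^esub> g) = k \<otimes>\<^bsub>End R M\<^esub> f \<oplus>\<^bsub>End R M\<^esub> k \<otimes>\<^bsub>End R M\<^esub> g"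
      using fgk by (auto simp: compose_def closed)
  qed
qed

text \<open>The inverse map of a bijective endomorphism is again linear, so bijectivity gives a
  unit; a non-zero element of \<open>M\<close> separates the identity from the zero map. After this,
  only kernels and images have to be inspected.\<close>

lemma brickI:
  assumes "fg_left_module R M" and nz: "carrier M \<noteq> {\<zero>\<^bsub>M\<^esub>}"
    and bij: "\<And>f. \<lbrakk>f \<in> module_hom R M M; f \<noteq> zero_hom M M\<rbrakk> \<Longrightarrow> bij_betw f (carrier M) (carrier M)"
  shows "brick R M"
proof -
  interpret fg_left_module R M by fact
  interpret E: ring "End R M" by (rule ring_End)
  obtain x where x: "x \<in> carrier M" "x \<noteq> \<zero>\<^bsub>M\<^esub>" using nz M.zero_closed by blast
  have one: "\<one>\<^bsub>End R M\<^esub> \<noteq> \<zero>\<^bsub>End R M\<^esub>"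
  proof
    assume "\<one>\<^bsub>End R M\<^esub> = \<zero>\<^bsub>End R M\<^esub>"
    then have "\<one>\<^bsub>End R M\<^esub> x = \<zero>\<^bsub>End R M\<^esub> x" by simp
    then show False using x by (simp add: End_def zero_hom_def)
  qed
  have "f \<in> Units (End R M)" if "f \<in> carrier (End R M) - {\<zero>\<^bsub>End R M\<^esub>}" for f
  proof -
    have f: "f \<in> module_hom R M M" "f \<noteq> zero_hom M M" using that by (auto simp: End_def)
    interpret f: left_module_hom R M M f using f(1) by unfold_locales
    have b: "bij_betw f (carrier M) (carrier M)" using bij f by blast
    let ?g = "\<lambda>y\<in>carrier M. inv_into (carrier M) f y"
    have "?g \<in> carrier (End R M)"
      using f.inverse_in_module_iso[OF b] by (simp add: module_iso_def End_def)
    moreover have "?g \<otimes>\<^bsub>End R M\<^esub> f = \<one>\<^bsub>End R M\<^esub>" "f \<otimes>\<^bsub>End R M\<^esub> ?g = \<one>\<^bsub>End R M\<^esub>"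
      using b compose_inv_into_id[OF b] compose_id_inv_into[of f "carrier M" "carrier M"]
      by (auto simp: End_def bij_betw_def)
    ultimately show ?thesis using that unfolding Units_def by auto
  qed
  moreover have "\<zero>\<^bsub>End R M\<^esub> \<notin> Units (End R M)"
    using one E.Units_l_inv E.r_null by (metis E.Units_closed E.Units_inv_closed)
  ultimately have "Units (End R M) = carrier (End R M) - {\<zero>\<^bsub>End R M\<^esub>}"
    using E.Units_closed by blast
  then have "division_ring (End R M)"
    using one E.ring_axioms by (simp add: division_ring_def division_ring_axioms_def)
  then show ?thesis using assms(1) by (simp add: brick_def)
qed

text \<open>Schur's lemma: kernel and image of a non-zero endomorphism are submodules, so the kernel
  is zero and the image is everything.\<close>

lemma simple_module_brick:
  assumes "fg_left_module R S" "simple_module R S"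
  shows "brick R S"
proof (rule brickI)
  fix f assume f: "f \<in> module_hom R S S" "f \<noteq> zero_hom S S"
  interpret fg_left_module R S by fact
  interpret f: left_module_hom R S S f using f(1) by unfold_locales
  have S: "\<And>N. submodule N R S \<Longrightarrow> N = {\<zero>\<^bsub>S\<^esub>} \<or> N = carrier S"
    using assms(2) by (auto simp: simple_module_def)
  have "a_kernel S S f \<noteq> carrier S"
    using f(2) f.zero_homI f.kernel_iff by blast
  then have "inj_on f (carrier S)"
    using S[OF f.submodule_kernel] f.inj_iff_kernel by blast
  moreover have "f ` carrier S \<noteq> {\<zero>\<^bsub>S\<^esub>}" using f(2) f.zero_homI by blast
  then have "f ` carrier S = carrier S" using S[OF f.submodule_image[OF submodule_carrier]] by blast
  ultimately show "bij_betw f (carrier S) (carrier S)" by (simp add: bij_betw_def)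
qed (use assms in \<open>auto simp: simple_module_def\<close>)

section \<open>Extensions\<close>

text \<open>The exactness part of membership in \<open>extensions\<close>, freed from finite
  generation and from list carriers, so that the three modules may live on unrelated types.\<close>

locale short_exact = i: left_module_hom R Y E i + p: left_module_hom R E X p
  for R :: "('a, 'r) ring_scheme" and Y :: "('a, 'y, 'u) module_scheme"
    and E :: "('a, 'e, 'v) module_scheme" and X :: "('a, 'x, 'w) module_scheme" and i p +
  assumes inj: "inj_on i (carrier Y)"
    and exact: "i ` carrier Y = a_kernel E X p"
    and surj: "p ` carrier E = carrier X"
begin

lemma p_i [simp]: "y \<in> carrier Y \<Longrightarrow> p (i y) = \<zero>\<^bsub>X\<^esub>"
  using exact p.kernel_iff[of "i y"] by blast

lemma kernel_lift:
  assumes "e \<in> carrier E" "p e = \<zero>\<^bsub>X\<^esub>"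
  obtains y where "y \<in> carrier Y" "i y = e"
proof -
  have "e \<in> i ` carrier Y" using assms by (simp add: exact p.kernel_iff)
  then show thesis using that by blast
qed

lemma i_eq_zero: "\<lbrakk>y \<in> carrier Y; i y = \<zero>\<^bsub>E\<^esub>\<rbrakk> \<Longrightarrow> y = \<zero>\<^bsub>Y\<^esub>"
  using inj_onD[OF inj, of y "\<zero>\<^bsub>Y\<^esub>"] by simp

definition section_of :: "('x \<Rightarrow> 'e) \<Rightarrow> bool" where
  "section_of s \<longleftrightarrow> s \<in> module_hom R X E \<and> (\<forall>x\<in>carrier X. p (s x) = x)"

text \<open>The difference of \<open>e\<close> and \<open>s (p e)\<close> lies in the kernel of
  \<open>p\<close>, hence comes from \<open>Y\<close>. The function \<open>r\<close> is obtained by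
  mere choice; its linearity is recovered later from the uniqueness of the decomposition.\<close>

lemma retraction_exists:
  assumes "section_of s"
  obtains r where "\<And>e. e \<in> carrier E \<Longrightarrow> r e \<in> carrier Y"
    and "\<And>e. e \<in> carrier E \<Longrightarrow> i (r e) \<oplus>\<^bsub>E\<^esub> s (p e) = e"
proof -
  have s: "s \<in> module_hom R X E" "\<And>x. x \<in> carrier X \<Longrightarrow> p (s x) = x"
    using assms by (auto simp: section_of_def)
  interpret s: left_module_hom R X E s using s(1) by unfold_locales
  have "\<exists>y\<in>carrier Y. i y \<oplus>\<^bsub>E\<^esub> s (p e) = e" if e: "e \<in> carrier E" for e
  proof -
    have "p (e \<oplus>\<^bsub>E\<^esub> \<ominus>\<^bsub>E\<^esub> s (p e)) = \<zero>\<^bsub>X\<^esub>" using e s(2) by (simp add: p.N.r_neg)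
    with e obtain y where "y \<in> carrier Y" "i y = e \<oplus>\<^bsub>E\<^esub> \<ominus>\<^bsub>E\<^esub> s (p e)"
      using kernel_lift[of "e \<oplus>\<^bsub>E\<^esub> \<ominus>\<^bsub>E\<^esub> s (p e)"] by auto
    then show ?thesis using e by (intro bexI[of _ y]) (simp_all add: i.N.a_assoc i.N.l_neg)
  qed
  then show thesis using that by metis
qed

end

text \<open>Each middle term is a direct sum of copies of \<open>Y\<close> and \<open>X\<close>,
  with coordinates \<open>r\<close>, \<open>p\<close> and \<open>r'\<close>, \<open>p'\<close>
  respectively. The isomorphism \<open>h\<close> carries the coordinates over, and so respects
  inclusions and projections.\<close>

lemma split_extensions_equivalent:
  assumes "short_exact R Y E X i p" "short_exact R Y E' X i' p'"
    and "short_exact.section_of R E X p s" "short_exact.section_of R E' X p' s'"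
  shows "\<exists>h\<in>module_iso R E E'.
    (\<forall>y\<in>carrier Y. h (i y) = i' y) \<and> (\<forall>e\<in>carrier E. p' (h e) = p e)"
proof -
  interpret a: short_exact R Y E X i p by fact
  interpret b: short_exact R Y E' X i' p' by fact
  interpret s: left_module_hom R X E s
    using assms(3) by unfold_locales (auto simp: a.section_of_def)
  interpret s': left_module_hom R X E' s'
    using assms(4) by unfold_locales (auto simp: b.section_of_def)
  have ps [simp]: "p (s x) = x" "p' (s' x) = x" if "x \<in> carrier X" for x
    using assms(3,4) that by (auto simp: a.section_of_def b.section_of_def)
  obtain r where r: "\<And>e. e \<in> carrier E \<Longrightarrow> r e \<in> carrier Y"
    "\<And>e. e \<in> carrier E \<Longrightarrow> i (r e) \<oplus>\<^bsub>E\<^esub> s (p e) = e"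
    using a.retraction_exists[OF assms(3)] by blast
  obtain r' where r': "\<And>e. e \<in> carrier E' \<Longrightarrow> r' e \<in> carrier Y"
    "\<And>e. e \<in> carrier E' \<Longrightarrow> i' (r' e) \<oplus>\<^bsub>E'\<^esub> s' (p' e) = e"
    using b.retraction_exists[OF assms(4)] by blast
  \<comment> \<open>Injectivity of \<open>i\<close> makes the \<open>Y\<close>-coordinate unique.
    This is what turns the chosen function \<open>r\<close> into a linear map.\<close>
  have rI: "r e = y" if "y \<in> carrier Y" "e \<in> carrier E" "i y \<oplus>\<^bsub>E\<^esub> s (p e) = e" for y e
  proof -
    have "i (r e) = i y"
      using r[OF that(2)] that by (metis a.i.N.add.right_cancel a.i.hom_closed a.p.hom_closed
          s.hom_closed)
    then show ?thesis using a.inj r(1) that by (metis inj_onD)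
  qed
  have r_add: "r (d \<oplus>\<^bsub>E\<^esub> e) = r d \<oplus>\<^bsub>Y\<^esub> r e" if "d \<in> carrier E" "e \<in> carrier E" for d e
  proof (rule rI)
    have "i (r d) \<oplus>\<^bsub>E\<^esub> i (r e) \<oplus>\<^bsub>E\<^esub> (s (p d) \<oplus>\<^bsub>E\<^esub> s (p e)) =
        (i (r d) \<oplus>\<^bsub>E\<^esub> s (p d)) \<oplus>\<^bsub>E\<^esub> (i (r e) \<oplus>\<^bsub>E\<^esub> s (p e))"
      using that r(1) by (simp add: a.i.N.a_ac)
    then show "i (r d \<oplus>\<^bsub>Y\<^esub> r e) \<oplus>\<^bsub>E\<^esub> s (p (d \<oplus>\<^bsub>E\<^esub> e)) = d \<oplus>\<^bsub>E\<^esub> e"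
      using that r by simp
  qed (use that r(1) in auto)
  have r_smult: "r (c \<odot>\<^bsub>E\<^esub> e) = c \<odot>\<^bsub>Y\<^esub> r e" if "c \<in> carrier R" "e \<in> carrier E" for c e
  proof (rule rI)
    have "c \<odot>\<^bsub>E\<^esub> i (r e) \<oplus>\<^bsub>E\<^esub> c \<odot>\<^bsub>E\<^esub> s (p e) = c \<odot>\<^bsub>E\<^esub> (i (r e) \<oplus>\<^bsub>E\<^esub> s (p e))"
      using that r(1) by (simp add: a.i.N.smult_r_distr)
    then show "i (c \<odot>\<^bsub>Y\<^esub> r e) \<oplus>\<^bsub>E\<^esub> s (p (c \<odot>\<^bsub>E\<^esub> e)) = c \<odot>\<^bsub>E\<^esub> e"
      using that r by simp
  qed (use that r(1) in auto)
  have r_i [simp]: "r (i y) = y" if "y \<in> carrier Y" for y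
    by (rule rI) (use that in auto)
  define h where "h = (\<lambda>e\<in>carrier E. i' (r e) \<oplus>\<^bsub>E'\<^esub> s' (p e))"
  have "h \<in> module_hom R E E'"
    using r(1) unfolding module_hom_def h_def
    by (auto simp: r_add r_smult b.i.N.a_ac b.i.N.smult_r_distr)
  then interpret h: left_module_hom R E E' h by unfold_locales
  have ph: "p' (h e) = p e" if "e \<in> carrier E" for e
    using that r(1) by (simp add: h_def)
  have hi: "h (i y) = i' y" if "y \<in> carrier Y" for y
    using that by (simp add: h_def)
  \<comment> \<open>Five lemma by hand: \<open>h\<close> preserves the projection, so its kernel
    lies in the image of \<open>i\<close>, on which \<open>h\<close> acts as the injective
    \<open>i'\<close>.\<close>
  have "e = \<zero>\<^bsub>E\<^esub>" if "e \<in> carrier E" "h e = \<zero>\<^bsub>E'\<^esub>" for e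
  proof -
    have "p e = \<zero>\<^bsub>X\<^esub>" using ph[OF that(1)] that(2) by simp
    from a.kernel_lift[OF that(1) this] obtain y where y: "y \<in> carrier Y" "i y = e" .
    then have "i' y = i' \<zero>\<^bsub>Y\<^esub>" using hi[OF y(1)] that(2) by (metis b.i.hom_zero)
    then have "y = \<zero>\<^bsub>Y\<^esub>" using inj_onD[OF b.inj _ y(1) a.i.M.M.zero_closed] by blast
    then show ?thesis using y(2) a.i.hom_zero by blast
  qed
  then have "inj_on h (carrier E)" by (auto simp: h.inj_iff_kernel h.kernel_iff)
  moreover have "e \<in> h ` carrier E" if "e \<in> carrier E'" for e
  proof (rule image_eqI)
    let ?d = "i (r' e) \<oplus>\<^bsub>E\<^esub> s (p' e)"
    show "?d \<in> carrier E" using r' that by simp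
    have "h (s (p' e)) = s' (p' e)"
    proof -
      have "r (s (p' e)) = \<zero>\<^bsub>Y\<^esub>" by (rule rI) (use that in auto)
      then show ?thesis using that by (simp add: h_def)
    qed
    then show "e = h ?d" using that r' hi by simp
  qed
  ultimately have "h \<in> module_iso R E E'"
    using h.hom by (auto simp: module_iso_def bij_betw_def)
  then show ?thesis using ph hi by blast
qed

lemma extensions_short_exact:
  assumes "left_module A X" "left_module A Y" "(E, i, p) \<in> extensions A X Y"
  shows "fg_left_module A E" "short_exact A Y E X i p"
proof -
  show E: "fg_left_module A E" using assms(3) by (simp add: extensions_def fg_modules_def)
  then interpret E: fg_left_module A E .
  show "short_exact A Y E X i p"
    using assms E.left_module_axioms
    by (simp add: extensions_def short_exact_def short_exact_axioms_def left_module_hom_def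
        left_module_hom_axioms_def)
qed

text \<open>If every extension splits, \<open>split_extensions_equivalent\<close> makes
  \<open>extension_equiv\<close> the full relation, so the quotient has at most one class, and that
  class is \<open>Ext1_zero\<close>.\<close>

lemma Ext1_nonzero_imp_nonsplit:
  assumes "left_module A X" "left_module A Y" "\<not> Ext1 A X Y \<subseteq> {Ext1_zero A X Y}"
  shows "\<exists>E i p. (E, i, p) \<in> extensions A X Y \<and> (\<nexists>s. short_exact.section_of A E X p s)"
proof (rule ccontr)
  assume none: "\<not> ?thesis"
  have section_of: "short_exact.section_of A E X p s \<longleftrightarrow>
      s \<in> module_hom A X E \<and> (\<forall>x\<in>carrier X. p (s x) = x)"
    if "(E, i, p) \<in> extensions A X Y" for E i p s
    using short_exact.section_of_def extensions_short_exact(2)[OF assms(1,2) that] by blast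
  have split: "\<exists>s. short_exact.section_of A E X p s" if "(E, i, p) \<in> extensions A X Y" for E i p
    using none that by blast
  then have zero: "Ext1_zero A X Y = extensions A X Y"
    using section_of unfolding Ext1_zero_def by (auto; blast)
  have "extension_equiv A X Y = extensions A X Y \<times> extensions A X Y"
  proof -
    have "(x, x') \<in> extension_equiv A X Y"
      if x: "x \<in> extensions A X Y" "x' \<in> extensions A X Y" for x x'
    proof -
      obtain E i p E' i' p' where eq: "x = (E, i, p)" "x' = (E', i', p')" by (metis prod_cases3)
      obtain s s' where "short_exact.section_of A E X p s" "short_exact.section_of A E' X p' s'"
        using split x eq by blast
      from split_extensions_equivalent[OF _ _ this] show ?thesis
        using extensions_short_exact(2)[OF assms(1,2)] x unfolding eq extension_equiv_def by blast
    qed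
    then show ?thesis by (auto simp: extension_equiv_def)
  qed
  then have "Ext1 A X Y \<subseteq> {Ext1_zero A X Y}"
    by (auto simp: Ext1_def zero quotient_def)
  then show False using assms(3) by blast
qed

section \<open>Non-split extensions of two simple modules: submodules and endomorphisms\<close>

locale nonsplit_simple_extension = short_exact A T E S i p
  for A :: "('a, 'r) ring_scheme" and T :: "('a, 't, 'u) module_scheme"
    and E :: "('a, 'e, 'v) module_scheme" and S :: "('a, 's, 'w) module_scheme" and i p +
  assumes simple_sub: "simple_module A T" and simple_quot: "simple_module A S"
    and nonsplit: "\<nexists>s. section_of s"
begin

lemma T_nonzero: "\<exists>t\<in>carrier T. t \<noteq> \<zero>\<^bsub>T\<^esub>"
proof -
  have "carrier T \<noteq> {\<zero>\<^bsub>T\<^esub>}" using simple_sub by (simp add: simple_module_def)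
  then show ?thesis using i.M.M.zero_closed by blast
qed

lemma S_nonzero: "\<exists>t\<in>carrier S. t \<noteq> \<zero>\<^bsub>S\<^esub>"
proof -
  have "carrier S \<noteq> {\<zero>\<^bsub>S\<^esub>}" using simple_quot by (simp add: simple_module_def)
  then show ?thesis using p.N.M.zero_closed by blast
qed

lemma image_i_nonzero: "i ` carrier T \<noteq> {\<zero>\<^bsub>E\<^esub>}"
proof
  assume eq: "i ` carrier T = {\<zero>\<^bsub>E\<^esub>}"
  obtain t where t: "t \<in> carrier T" "t \<noteq> \<zero>\<^bsub>T\<^esub>" using T_nonzero by blast
  then show False using eq i_eq_zero[of t] by blast
qed

lemma image_i_proper: "i ` carrier T \<noteq> carrier E"
proof
  assume "i ` carrier T = carrier E"
  then have "p e = \<zero>\<^bsub>S\<^esub>" if "e \<in> carrier E" for e using that p.kernel_iff[of e] exact by blast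
  then show False using surj S_nonzero by (metis imageE)
qed

text \<open>The image of \<open>U\<close> in \<open>S\<close> and its preimage in \<open>T\<close>
  are each zero or everything, which leaves four combinations. Three of them are the listed
  submodules. In the fourth, \<open>U\<close> meets the copy of \<open>T\<close> in zero and maps
  onto \<open>S\<close>; it is then a complement and splits the sequence.\<close>

lemma submodule_cases:
  assumes U: "submodule U A E"
  shows "U = {\<zero>\<^bsub>E\<^esub>} \<or> U = i ` carrier T \<or> U = carrier E"
proof -
  note UD = i.N.submoduleD[OF U]
  have T: "V = {\<zero>\<^bsub>T\<^esub>} \<or> V = carrier T" if "submodule V A T" for V
    using simple_sub that by (auto simp: simple_module_def)
  have S: "V = {\<zero>\<^bsub>S\<^esub>} \<or> V = carrier S" if "submodule V A S" for V
    using simple_quot that by (auto simp: simple_module_def)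
  have ker: "u \<in> i ` carrier T" if "u \<in> carrier E" "p u = \<zero>\<^bsub>S\<^esub>" for u
    using that by (simp add: exact p.kernel_iff)
  consider "p ` U = {\<zero>\<^bsub>S\<^esub>}" | "p ` U = carrier S" using S[OF p.submodule_image[OF U]] by blast
  then show ?thesis
  proof cases
    case 1
    then have sub: "U \<subseteq> i ` carrier T" using UD(1) ker by blast
    from T[OF i.submodule_vimage[OF U]] show ?thesis
    proof
      assume int: "{x \<in> carrier T. i x \<in> U} = {\<zero>\<^bsub>T\<^esub>}"
      have "u = \<zero>\<^bsub>E\<^esub>" if "u \<in> U" for u
      proof -
        obtain t where t: "t \<in> carrier T" "u = i t" using sub \<open>u \<in> U\<close> by blast
        then have "t \<in> {x \<in> carrier T. i x \<in> U}" using \<open>u \<in> U\<close> by simp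
        then show ?thesis unfolding int using t(2) by simp
      qed
      then show ?thesis using UD(2) by blast
    next
      assume "{x \<in> carrier T. i x \<in> U} = carrier T"
      then show ?thesis using sub by blast
    qed
  next
    case 2
    from T[OF i.submodule_vimage[OF U]] show ?thesis
    proof
      assume int: "{x \<in> carrier T. i x \<in> U} = {\<zero>\<^bsub>T\<^esub>}"
      \<comment> \<open>\<open>p\<close> is injective on \<open>U\<close>, since the difference of
        two elements with equal image lies both in \<open>U\<close> and in the copy of
        \<open>T\<close>. Hence the \<open>SOME\<close> in \<open>s\<close> below is a unique
        choice, and \<open>s\<close> inherits linearity from \<open>p\<close>.\<close>
      have uniq: "u = v" if "u \<in> U" "v \<in> U" "p u = p v" for u v
      proof -
        have uv: "u \<in> carrier E" "v \<in> carrier E" using that UD(1) by auto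
        then have "p (u \<oplus>\<^bsub>E\<^esub> \<ominus>\<^bsub>E\<^esub> v) = \<zero>\<^bsub>S\<^esub>" using that(3) by (simp add: p.N.r_neg)
        with uv obtain t where t: "t \<in> carrier T" "i t = u \<oplus>\<^bsub>E\<^esub> \<ominus>\<^bsub>E\<^esub> v"
          using kernel_lift[of "u \<oplus>\<^bsub>E\<^esub> \<ominus>\<^bsub>E\<^esub> v"] by auto
        moreover have "u \<oplus>\<^bsub>E\<^esub> \<ominus>\<^bsub>E\<^esub> v \<in> U" using that UD(3,4) by blast
        ultimately have "t \<in> {x \<in> carrier T. i x \<in> U}" by simp
        then have "t = \<zero>\<^bsub>T\<^esub>" unfolding int by simp
        then have "u \<oplus>\<^bsub>E\<^esub> \<ominus>\<^bsub>E\<^esub> v = \<zero>\<^bsub>E\<^esub>" using t by simp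
        then show ?thesis using uv by (metis i.N.eq_if_add_uminus_eq_zero)
      qed
      define s where "s = (\<lambda>x\<in>carrier S. SOME u. u \<in> U \<and> p u = x)"
      have s: "s x \<in> U \<and> p (s x) = x" if "x \<in> carrier S" for x
      proof -
        have "x \<in> p ` U" using that 2 by simp
        then have "\<exists>u. u \<in> U \<and> p u = x" by blast
        from someI_ex[OF this] show ?thesis using that by (simp add: s_def)
      qed
      have sE: "s x \<in> carrier E" if "x \<in> carrier S" for x using s[OF that] UD(1) by blast
      have "s \<in> module_hom A S E"
        unfolding module_hom_def
      proof (intro CollectI conjI ballI)
        show "s \<in> carrier S \<rightarrow>\<^sub>E carrier E" using sE by (auto simp: s_def)
        show "s (x \<oplus>\<^bsub>S\<^esub> y) = s x \<oplus>\<^bsub>E\<^esub> s y" if "x \<in> carrier S" "y \<in> carrier S" for x y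
          using that s sE UD(3) by (intro uniq) auto
        show "s (a \<odot>\<^bsub>S\<^esub> x) = a \<odot>\<^bsub>E\<^esub> s x" if "a \<in> carrier A" "x \<in> carrier S" for a x
          using that s sE UD(5) by (intro uniq) auto
      qed
      then have "section_of s" using s by (simp add: section_of_def)
      then show ?thesis using nonsplit by blast
    next
      assume "{x \<in> carrier T. i x \<in> U} = carrier T"
      then have T_le: "i t \<in> U" if "t \<in> carrier T" for t using that by blast
      have "e \<in> U" if e: "e \<in> carrier E" for e
      proof -
        have "p e \<in> p ` U" using 2 e by simp
        then obtain u where u: "u \<in> U" "p u = p e" by (metis imageE)
        then have uE: "u \<in> carrier E" using UD(1) by blast
        have "p (e \<oplus>\<^bsub>E\<^esub> \<ominus>\<^bsub>E\<^esub> u) = \<zero>\<^bsub>S\<^esub>" using e u uE by (simp add: p.N.r_neg)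
        with e uE obtain t where "t \<in> carrier T" "i t = e \<oplus>\<^bsub>E\<^esub> \<ominus>\<^bsub>E\<^esub> u"
          using kernel_lift[of "e \<oplus>\<^bsub>E\<^esub> \<ominus>\<^bsub>E\<^esub> u"] by auto
        then have "e \<oplus>\<^bsub>E\<^esub> \<ominus>\<^bsub>E\<^esub> u \<in> U" using T_le by metis
        then have "(e \<oplus>\<^bsub>E\<^esub> \<ominus>\<^bsub>E\<^esub> u) \<oplus>\<^bsub>E\<^esub> u \<in> U" using u UD(3) by blast
        then show ?thesis using e uE by (simp add: i.N.a_assoc i.N.l_neg)
      qed
      then show ?thesis using UD(1) by blast
    qed
  qed
qed

text \<open>A non-zero \<open>f\<close> has kernel zero or the copy \<open>?I\<close> of
  \<open>T\<close>, and image \<open>?I\<close> or \<open>E\<close>. Only the bijective combination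
  survives; \<open>not_iso\<close> is what excludes kernel and image both equal to
  \<open>?I\<close>.\<close>

lemma brick_middle:
  assumes fg: "fg_left_module A E" and not_iso: "\<not> isomorphic A S T"
  shows "brick A E"
proof (rule brickI[OF fg])
  show "carrier E \<noteq> {\<zero>\<^bsub>E\<^esub>}"
    using image_i_nonzero image_i_proper submodule_cases i.submodule_image[OF i.M.submodule_carrier]
      i.N.submoduleD(1,2) by blast
  fix f assume f: "f \<in> module_hom A E E" "f \<noteq> zero_hom E E"
  interpret f: left_module_hom A E E f using f(1) by unfold_locales
  let ?I = "i ` carrier T"
  have subI: "submodule ?I A E" by (rule i.submodule_image[OF i.M.submodule_carrier])
  have I_le: "?I \<subseteq> carrier E" by auto
  have ker_all: "a_kernel E E f \<noteq> carrier E"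
    using f(2) f.zero_homI f.kernel_iff by blast
  have im_zero: "f ` carrier E \<noteq> {\<zero>\<^bsub>E\<^esub>}" using f(2) f.zero_homI by blast
  note im = submodule_cases[OF f.submodule_image[OF i.N.submodule_carrier]]
  from submodule_cases[OF f.submodule_kernel] ker_all
  consider "a_kernel E E f = {\<zero>\<^bsub>E\<^esub>}" | "a_kernel E E f = ?I" by blast
  then show "bij_betw f (carrier E) (carrier E)"
  proof cases
    case 1
    then have inj: "inj_on f (carrier E)" by (simp add: f.inj_iff_kernel)
    \<comment> \<open>Stands in for a length count: if \<open>f\<close> mapped \<open>E\<close>
      injectively onto \<open>?I\<close>, then \<open>f\<close> would send \<open>?I\<close> to a
      non-zero submodule inside \<open>?I\<close>, hence onto \<open>?I\<close>, and injectivity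
      would give that \<open>?I\<close> is all of \<open>E\<close>.\<close>
    have "f ` carrier E \<noteq> ?I"
    proof
      assume im: "f ` carrier E = ?I"
      have "f ` ?I \<noteq> {\<zero>\<^bsub>E\<^esub>}"
      proof
        assume "f ` ?I = {\<zero>\<^bsub>E\<^esub>}"
        then have "?I \<subseteq> a_kernel E E f" using I_le f.kernel_iff by blast
        then show False using 1 image_i_nonzero i.N.submoduleD(2)[OF subI] by blast
      qed
      moreover have "f ` ?I \<noteq> carrier E" using im I_le image_i_proper by blast
      ultimately have "f ` ?I = f ` carrier E" using submodule_cases[OF f.submodule_image[OF subI]] im by blast
      then show False
        using inj_on_image_eq_iff[OF inj I_le subset_refl] image_i_proper by blast
    qed
    then show ?thesis using im im_zero inj by (auto simp: bij_betw_def)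
  next
    case 2
    from im im_zero consider "f ` carrier E = carrier E" | "f ` carrier E = ?I" by blast
    then show ?thesis
    proof cases
      case onto: 1
      \<comment> \<open>The preimage of \<open>?I\<close> contains the kernel \<open>?I\<close> and
        is proper because \<open>f\<close> is onto, so it is the kernel itself. But then
        \<open>f\<close> kills it while mapping it onto \<open>?I\<close>.\<close>
      let ?V = "{x \<in> carrier E. f x \<in> ?I}"
      have "?I \<subseteq> ?V"
      proof
        fix e assume "e \<in> ?I"
        then have "e \<in> carrier E" "f e = \<zero>\<^bsub>E\<^esub>" using 2 f.kernel_iff[of e] by auto
        then show "e \<in> ?V" using i.N.submoduleD(2)[OF subI] by simp
      qed
      moreover have "?V \<noteq> carrier E"
      proof
        assume "?V = carrier E"
        then have "f ` carrier E \<subseteq> ?I" by blast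
        then show False using onto I_le image_i_proper by simp
      qed
      moreover have "?V \<noteq> {\<zero>\<^bsub>E\<^esub>}"
        using \<open>?I \<subseteq> ?V\<close> image_i_nonzero i.N.submoduleD(2)[OF subI] by (metis empty_iff subset_singletonD)
      ultimately have V_eq: "?V = ?I"
        using submodule_cases[OF f.submodule_vimage[OF subI]] by metis
      have "e = \<zero>\<^bsub>E\<^esub>" if "e \<in> ?I" for e
      proof -
        from that have "e \<in> f ` carrier E" using onto I_le by blast
        then obtain d where d: "d \<in> carrier E" "e = f d" by blast
        then have "d \<in> ?V" using that by simp
        then have "d \<in> a_kernel E E f" unfolding V_eq 2 .
        then show ?thesis using d f.kernel_iff[of d] by simp
      qed
      then show ?thesis using image_i_nonzero i.N.submoduleD(2)[OF subI] by blast
    next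
      \<comment> \<open>Here \<open>S \<simeq> E / T \<simeq> f E = T\<close>, which is excluded; \<open>g\<close> is the composite isomorphism.\<close>
      case into: 2
      define g where "g = (\<lambda>x\<in>carrier S. THE t. t \<in> carrier T \<and> (\<exists>e\<in>carrier E. p e = x \<and> f e = i t))"
      \<comment> \<open>Well-definedness: two elements of \<open>E\<close> over the same element of
        \<open>S\<close> differ by an element of the kernel of \<open>p\<close>, which is
        \<open>?I\<close> and therefore also the kernel of \<open>f\<close>.\<close>
      have g: "g (p e) = t" if e: "e \<in> carrier E" and t: "t \<in> carrier T" "f e = i t" for e t
      proof -
        have "t' = t" if t': "t' \<in> carrier T" "e' \<in> carrier E" "p e' = p e" "f e' = i t'" for t' e'
        proof -
          have "p (e' \<oplus>\<^bsub>E\<^esub> \<ominus>\<^bsub>E\<^esub> e) = \<zero>\<^bsub>S\<^esub>" using e t' by (simp add: p.N.r_neg)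
          then have "e' \<oplus>\<^bsub>E\<^esub> \<ominus>\<^bsub>E\<^esub> e \<in> a_kernel E E f"
            using e t' exact 2 p.kernel_iff by simp
          then have "f e' \<oplus>\<^bsub>E\<^esub> \<ominus>\<^bsub>E\<^esub> f e = \<zero>\<^bsub>E\<^esub>" using e t' f.kernel_iff by simp
          then have "i t' = i t" using e t t'
            by (metis f.hom_closed i.N.eq_if_add_uminus_eq_zero)
          then show ?thesis using inj t t' by (auto dest: inj_onD)
        qed
        then have "(THE t. t \<in> carrier T \<and> (\<exists>e'\<in>carrier E. p e' = p e \<and> f e' = i t)) = t"
          using e t by (intro the_equality) blast+
        then show ?thesis using e by (simp add: g_def)
      qed
      have lift: thesis
        if "x \<in> carrier S"
          and that': "\<And>e t. \<lbrakk>e \<in> carrier E; t \<in> carrier T; p e = x; f e = i t\<rbrakk> \<Longrightarrow> thesis"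
        for x thesis
      proof -
        have "x \<in> p ` carrier E" using that(1) surj by simp
        then obtain e where e: "e \<in> carrier E" "p e = x" by blast
        then have "f e \<in> ?I" unfolding into[symmetric] by simp
        then obtain t where "t \<in> carrier T" "f e = i t" by blast
        then show thesis using that' e by blast
      qed
      have "g \<in> module_hom A S T"
        unfolding module_hom_def
      proof (intro CollectI conjI ballI)
        show "g \<in> carrier S \<rightarrow>\<^sub>E carrier T"
        proof (rule PiE_I)
          fix x assume "x \<in> carrier S"
          then obtain e t where e: "e \<in> carrier E" "t \<in> carrier T" "p e = x" "f e = i t"
            by (rule lift)
          then show "g x \<in> carrier T" using g[of e t] by simp
        qed (simp add: g_def)
        fix x assume "x \<in> carrier S"
        then obtain e t where e: "e \<in> carrier E" "t \<in> carrier T" "p e = x" "f e = i t"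
          by (rule lift)
        show "g (x \<oplus>\<^bsub>S\<^esub> y) = g x \<oplus>\<^bsub>T\<^esub> g y" if "y \<in> carrier S" for y
        proof -
          obtain e' t' where e': "e' \<in> carrier E" "t' \<in> carrier T" "p e' = y" "f e' = i t'"
            using \<open>y \<in> carrier S\<close> by (rule lift)
          show ?thesis
            using g[of "e \<oplus>\<^bsub>E\<^esub> e'" "t \<oplus>\<^bsub>T\<^esub> t'"] g[of e t] g[of e' t'] e e' by simp
        qed
        show "g (a \<odot>\<^bsub>S\<^esub> x) = a \<odot>\<^bsub>T\<^esub> g x" if "a \<in> carrier A" for a
          using g[of "a \<odot>\<^bsub>E\<^esub> e" "a \<odot>\<^bsub>T\<^esub> t"] g[of e t] e that by simp
      qed
      moreover from this interpret g: left_module_hom A S T g by unfold_locales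
      have "x = \<zero>\<^bsub>S\<^esub>" if "x \<in> carrier S" "g x = \<zero>\<^bsub>T\<^esub>" for x
      proof -
        obtain e t where e: "e \<in> carrier E" "t \<in> carrier T" "p e = x" "f e = i t"
          using \<open>x \<in> carrier S\<close> by (rule lift)
        then have "t = \<zero>\<^bsub>T\<^esub>" using g[of e t] that(2) by simp
        then have "f e = \<zero>\<^bsub>E\<^esub>" using e(4) by simp
        then have "e \<in> a_kernel E S p" using e(1) f.kernel_iff[of e] by (simp add: 2 exact)
        then show ?thesis using e p.kernel_iff[of e] by simp
      qed
      then have "inj_on g (carrier S)" by (auto simp: g.inj_iff_kernel g.kernel_iff)
      moreover have "t \<in> g ` carrier S" if t: "t \<in> carrier T" for t
      proof -
        have "i t \<in> f ` carrier E" using t by (simp add: into)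
        then obtain e where "e \<in> carrier E" "f e = i t" by (metis imageE)
        then show ?thesis using g[of e t] t by (intro image_eqI[of _ _ "p e"]) auto
      qed
      ultimately have "g \<in> module_iso A S T" by (auto simp: module_iso_def bij_betw_def)
      then show ?thesis using not_iso by (auto simp: isomorphic_def)
    qed
  qed
qed

end

section \<open>Brick cycles\<close>

text \<open>One step of a brick-cycle as a relation, so that paths are concatenated in its
  transitive closure, with no indexing of modules and maps.\<close>

definition brick_arrow :: "('a, 'r) ring_scheme \<Rightarrow> 'a list_module rel" where
  "brick_arrow A = {(X, Y). brick A X \<and> brick A Y \<and>
    (\<exists>f\<in>module_hom A X Y. f \<noteq> zero_hom X Y \<and> f \<notin> module_iso A X Y)}"

text \<open>A closed path of the relation is a power of it, whose points give the modules and from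
  which choice gives the maps. The path closes at the very same module, so reflexivity supplies the
  isomorphism of the ends.\<close>

lemma brick_cycle_if_trancl_brick_arrow:
  assumes "(X, X) \<in> (brick_arrow A)\<^sup>+"
  shows "\<exists>m X f. brick_cycle A m X f"
proof -
  obtain m where m: "m > 0" "(X, X) \<in> brick_arrow A ^^ m"
    using assms by (auto simp: trancl_power)
  then obtain Z where Z: "Z 0 = X" "Z m = X" "\<And>j. j < m \<Longrightarrow> (Z j, Z (Suc j)) \<in> brick_arrow A"
    by (auto simp: relpow_fun_conv)
  obtain f where f: "\<And>j. j < m \<Longrightarrow> f j \<in> module_hom A (Z j) (Z (Suc j)) \<and>
      f j \<noteq> zero_hom (Z j) (Z (Suc j)) \<and> f j \<notin> module_iso A (Z j) (Z (Suc j))"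
    using Z(3) unfolding brick_arrow_def by simp metis
  have "brick A (Z 0)" using Z(3)[of 0] m by (auto simp: brick_arrow_def)
  moreover have brick: "brick A (Z j)" if "j \<le> m" for j
    using Z(3)[of j] that Z(1,2) \<open>brick A (Z 0)\<close>
    by (cases "j = m") (auto simp: brick_arrow_def)
  moreover have "isomorphic A (Z 0) (Z m)"
    using \<open>brick A (Z 0)\<close> Z(1,2)
    by (auto simp: brick_def fg_left_module_def intro: isomorphic_refl)
  ultimately show ?thesis using m f unfolding brick_cycle_def by (metis Suc_leI One_nat_def)
qed

section \<open>From arcs and walks of the Ext-quiver to paths of bricks\<close>

lemma simple_modulesD:
  assumes "S \<in> simple_modules A"
  shows "fg_left_module A S" "left_module A S" "simple_module A S" "brick A S"
proof -
  show fg: "fg_left_module A S" and S: "simple_module A S"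
    using assms by (simp_all add: simple_modules_def fg_modules_def)
  show "left_module A S" using S by (simp add: simple_module_def)
  show "brick A S" by (rule simple_module_brick[OF fg S])
qed

lemma iso_class_self: "S \<in> simple_modules A \<Longrightarrow> S \<in> iso_class A S"
  using isomorphic_refl[OF simple_modulesD(2)]
  by (simp add: iso_class_def iso_rel_def simple_modules_def)

lemma iso_class_eq:
  assumes "isomorphic A M N" "M \<in> fg_modules A" "N \<in> fg_modules A"
  shows "iso_class A M = iso_class A N"
proof -
  have lm: "left_module A M" if "M \<in> fg_modules A" for M
    using that by (auto simp: fg_modules_def fg_left_module_def)
  show ?thesis
    using assms lm isomorphic_sym isomorphic_trans
    unfolding iso_class_def iso_rel_def by (auto; blast)
qed

text \<open>An arc only says that some representatives \<open>S\<close> and \<open>T\<close> have a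
  non-zero extension, whereas the path has to join the prescribed \<open>T'\<close> and
  \<open>S'\<close>; so the isomorphisms \<open>u\<close> and \<open>v\<close> are composed with the
  inclusion and the projection. The first composite is not onto and the second kills the copy of
  \<open>T\<close>, so neither is invertible.\<close>

lemma Ext_arrow_brick_path:
  assumes ST: "S \<in> simple_modules A" "T \<in> simple_modules A"
    and ext: "\<not> Ext1 A S T \<subseteq> {Ext1_zero A S T}"
    and ne: "iso_class A S \<noteq> iso_class A T"
    and ST': "S' \<in> simple_modules A" "isomorphic A S S'"
      "T' \<in> simple_modules A" "isomorphic A T' T"
  shows "(T', S') \<in> (brick_arrow A)\<^sup>+"
proof -
  note S = simple_modulesD[OF ST(1)] and T = simple_modulesD[OF ST(2)]
  note S' = simple_modulesD[OF ST'(1)] and T' = simple_modulesD[OF ST'(3)]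
  interpret S': left_module A S' by (rule S'(2))
  obtain E i p where E: "(E, i, p) \<in> extensions A S T" "\<nexists>s. short_exact.section_of A E S p s"
    using Ext1_nonzero_imp_nonsplit[OF S(2) T(2) ext] by metis
  note se = extensions_short_exact[OF S(2) T(2) E(1)]
  interpret short_exact A T E S i p by (rule se)
  interpret nonsplit_simple_extension A T E S i p
    using E(2) S(3) T(3) by unfold_locales auto
  have "\<not> isomorphic A S T"
    using iso_class_eq[of A S T] ne ST by (auto simp: simple_modules_def)
  then have brickE: "brick A E" using brick_middle se(1) by blast
  obtain u where u: "u \<in> module_iso A T' T" using ST' by (auto simp: isomorphic_def)
  obtain v where v: "v \<in> module_iso A S S'" using ST' by (auto simp: isomorphic_def)
  let ?f = "compose (carrier T') i u" and ?g = "compose (carrier E) v p"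
  have "(T', E) \<in> brick_arrow A"
  proof -
    have hom: "?f \<in> module_hom A T' E"
      using module_hom_compose[OF T'(2) _ i.hom] u by (auto simp: module_iso_def)
    have "u ` carrier T' = carrier T" using u by (auto simp: module_iso_def bij_betw_def)
    then have im: "?f ` carrier T' = i ` carrier T"
      by (simp add: compose_def image_image[symmetric])
    have "?f \<noteq> zero_hom T' E"
    proof
      assume "?f = zero_hom T' E"
      then have "i ` carrier T \<subseteq> {\<zero>\<^bsub>E\<^esub>}" unfolding im[symmetric] by (auto simp: zero_hom_def)
      then show False using T_nonzero i_eq_zero by blast
    qed
    moreover have "?f \<notin> module_iso A T' E"
      using im image_i_proper by (auto simp: module_iso_def bij_betw_def)
    ultimately show ?thesis using hom T'(4) brickE by (auto simp: brick_arrow_def)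
  qed
  moreover have "(E, S') \<in> brick_arrow A"
  proof -
    have hom: "?g \<in> module_hom A E S'"
      using module_hom_compose[OF i.N.left_module_axioms p.hom] v by (auto simp: module_iso_def)
    have "v ` carrier S = carrier S'" using v by (auto simp: module_iso_def bij_betw_def)
    then have im: "?g ` carrier E = carrier S'"
      using surj by (simp add: compose_def image_image[symmetric])
    have "?g \<noteq> zero_hom E S'"
    proof
      assume "?g = zero_hom E S'"
      then have "carrier S' \<subseteq> {\<zero>\<^bsub>S'\<^esub>}" unfolding im[symmetric] by (auto simp: zero_hom_def)
      then show False
        using S'(3) S'.M.zero_closed unfolding simple_module_def by blast
    qed
    moreover have "?g \<notin> module_iso A E S'"
    proof
      assume "?g \<in> module_iso A E S'"
      then have inj': "inj_on ?g (carrier E)" by (simp add: module_iso_def bij_betw_def)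
      obtain t where t: "t \<in> carrier T" "t \<noteq> \<zero>\<^bsub>T\<^esub>" using T_nonzero by blast
      then have "?g (i t) = ?g (i \<zero>\<^bsub>T\<^esub>)" by (simp add: compose_def)
      then have "i t = i \<zero>\<^bsub>T\<^esub>" using inj' t by (meson i.M.M.zero_closed i.hom_closed inj_onD)
      then show False using i_eq_zero[of t] t by simp
    qed
    ultimately show ?thesis using hom S'(4) brickE by (auto simp: brick_arrow_def)
  qed
  ultimately show ?thesis by (rule trancl.trancl_into_trancl[OF trancl.r_into_trancl])
qed

lemma pair_wf_digraph_Ext_quiver: "pair_wf_digraph (Ext_quiver A)"
  by unfold_locales (auto simp: Ext_quiver_def)

text \<open>Induction along the walk, on its last arc. If that arc is a loop it is dropped; if it
  starts at \<open>a\<close> it gives the path alone; otherwise two paths are joined at the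
  representative \<open>X\<close> of \<open>b\<close>. \<open>T\<close> is kept arbitrary because
  the induction hypothesis is used at \<open>X\<close>.\<close>

lemma walk_brick_path:
  assumes "(a, b) \<in> (parcs (Ext_quiver A))\<^sup>*" "a \<noteq> b"
    and "S \<in> a" "S \<in> simple_modules A" "T \<in> b" "T \<in> simple_modules A"
  shows "(T, S) \<in> (brick_arrow A)\<^sup>+"
  using assms
proof (induction arbitrary: T rule: rtrancl_induct)
  case (step b c)
  obtain X Y where XY: "X \<in> simple_modules A" "Y \<in> simple_modules A"
    "b = iso_class A X" "c = iso_class A Y" "\<not> Ext1 A X Y \<subseteq> {Ext1_zero A X Y}"
    using step.hyps(2) by (auto simp: Ext_quiver_def)
  have T: "isomorphic A T Y"
    using step.prems(4) XY(4)
      isomorphic_sym[OF simple_modulesD(2)[OF XY(2)] simple_modulesD(2)[OF step.prems(5)]]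
    by (simp add: iso_class_def iso_rel_def)
  have arrow: "(T, Z) \<in> (brick_arrow A)\<^sup>+"
    if "b \<noteq> c" "Z \<in> b" "Z \<in> simple_modules A" for Z
    using that XY T step.prems(5)
    by (intro Ext_arrow_brick_path[of X A Y]) (auto simp: iso_class_def iso_rel_def)
  consider "a = b" | "b = c" "a \<noteq> b" | "a \<noteq> b" "b \<noteq> c" by blast
  then show ?case
  proof cases
    case 1
    then show ?thesis using step.prems(1-3) by (intro arrow) simp_all
  next
    case 2
    then show ?thesis using step.prems by (intro step.IH) simp_all
  next
    case 3
    have X: "X \<in> b" unfolding XY(3) by (rule iso_class_self[OF XY(1)])
    have "(X, S) \<in> (brick_arrow A)\<^sup>+" by (rule step.IH[OF 3(1) step.prems(2,3) X XY(1)])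
    with arrow[OF 3(2) X XY(1)] show ?thesis by (rule trancl_trans)
  qed
qed simp

theorem corollary1p5:
  fixes K :: "('k, 'x) ring_scheme" and A :: "('k, 'a, 'y) module_scheme"
  assumes "fin_dim_algebra K A"
    and "brick_directed A"
  shows "weakly_triangular A"
  unfolding weakly_triangular_def
proof (intro allI impI ballI, rule ccontr)
  interpret Q: pair_wf_digraph "Ext_quiver A" by (rule pair_wf_digraph_Ext_quiver)
  fix u c v
  assume c: "c \<noteq> [] \<and> pre_digraph.awalk (with_proj (Ext_quiver A)) u c u"
    and v: "v \<in> set (pre_digraph.awalk_verts (with_proj (Ext_quiver A)) u c)" and ne: "v \<noteq> u"
  \<comment> \<open>The closed walk is cut at \<open>v\<close> into a walk from \<open>u\<close> to
    \<open>v\<close> and one back.\<close>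
  have path: "(u, v) \<in> (parcs (Ext_quiver A))\<^sup>*" "(v, u) \<in> (parcs (Ext_quiver A))\<^sup>*"
    using Q.awalk_verts_reachable_from Q.awalk_verts_reachable_to c v
      Q.reachable_conv by auto
  have "u \<in> pverts (Ext_quiver A)" "v \<in> pverts (Ext_quiver A)" using c v by auto
  then obtain S T where S: "S \<in> u" "S \<in> simple_modules A" and T: "T \<in> v" "T \<in> simple_modules A"
    using iso_class_self by (auto simp: Ext_quiver_def)
  \<comment> \<open>Each walk yields a path of bricks in the opposite direction. One simple module
    is fixed per vertex, so the two paths fit together into a closed one.\<close>
  have "(S, T) \<in> (brick_arrow A)\<^sup>+" "(T, S) \<in> (brick_arrow A)\<^sup>+"
    using walk_brick_path[OF path(2) ne T S] walk_brick_path[OF path(1) ne[symmetric] S T] .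
  then have "(S, S) \<in> (brick_arrow A)\<^sup>+" by (rule trancl_trans)
  from brick_cycle_if_trancl_brick_arrow[OF this] show False
    using assms(2) unfolding brick_directed_def by blast
qed

end
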